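(* Let $f$ be a non-linear metric $f(R)$ gravity model, i.e. $f''(R)\neq 0$. No spherically symmetric vacuum exterior spacetime with constant Ricci scalar $R^+$ (whether static or not) can be smoothly matched, in the sense of metric $f(R)$ gravity, to the interior of a collapsing uniform-density dust star.
   Context: Conventions: signature $(+,-,-,-)$, $c=1$, $\kappa=8\pi G>0$, Riemann tensor $R^{\rho}{}_{\sigma\mu\nu}=\partial_\nu\Gamma^\rho_{\sigma\mu}+\Gamma^\rho_{\lambda\nu}\Gamma^\lambda_{\sigma\mu}-(\mu\leftrightarrow\nu)$, $R_{\mu\nu}=R^\lambda{}_{\mu\lambda\nu}$, $R=g^{\mu\nu}R_{\mu\nu}$. $f$ is a smooth real function on an interval, $f_R=f'$. The field equations of metric $f(R)$ gravity are $$f_R(R)R_{\mu\nu}-\tfrac12 f(R)g_{\mu\nu}+(\nabla_\mu\nabla_\nu-g_{\mu\nu}\square)f_R(R)=-\kappa T_{\mu\nu}.$$ Interior (collapsing uniform-density dust star): constants $k\in\mathbb R$, $\rho_0>0$, $\chi_*>0$ with $1-k\chi_*^2>0$, and a smooth scale factor $a(\tau)>0$ on $[0,\tau_c)$ with $a(0)=1$, $\dot a(0)=0$ and $\dot a(\tau)<0$ for $0<\tau<\tau_c$ (collapse). The metric, for $0\le \chi\le\chi_*$, is $$ds_-^2=d\tau^2-a^2(\tau)\left(\frac{d\chi^2}{1-k\chi^2}+\chi^2d\Omega_{(2)}^2\right),$$ and it satisfies the field equations with $T_{\mu\nu}=\rho u_\mu u_\nu$, $u=\partial_\tau$, $\rho(\tau)=\rho_0/a^3(\tau)$.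 Its Ricci scalar is $R^-=6\left(\frac{\dot a^2+k}{a^2}+\frac{\ddot a}{a}\right)$. Exterior: a spherically symmetric metric, written in areal-radius coordinates $(t,r,\theta,\varphi)$ as $ds_+^2=A(t,r)dt^2-B(t,r)dr^2-r^2d\Omega_{(2)}^2$ with smooth $A,B>0$, solving the field equations with $T_{\mu\nu}=0$. Matching surface: the timelike hypersurface $\Sigma_*$ given by $\chi=\chi_*$ in interior coordinates and by $t=t_*(\tau)$, $r=r_*(\tau)$ (smooth, $\dot t_*>0$) in exterior coordinates, with intrinsic coordinates $(\tau,\theta,\varphi)$. Smooth matching: for a quantity $Q$, $[Q]$ is the difference of its values on $\Sigma_*$ computed from the exterior and from the interior. The interior and exterior are smoothly matched in non-linear metric $f(R)$ gravity if all four junction conditions hold along $\Sigma_*$: $[h_{ab}]=0$ (induced metric), $[K_{ab}]=0$ (extrinsic curvature), $[R]=0$, and $[n^\mu\partial_\mu R]=0$, where $n$ is the unit normal to $\Sigma_*$. *)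

theory Defs
  imports "HOL-Analysis.Analysis"
begin

section \<open>Smooth functions\<close>

primrec Ck_on :: "nat \<Rightarrow> 'a::real_normed_vector set \<Rightarrow> ('a \<Rightarrow> 'b::real_normed_vector) \<Rightarrow> bool" where
  "Ck_on 0 S f \<longleftrightarrow> continuous_on S f"
| "Ck_on (Suc n) S f \<longleftrightarrow>
     (\<forall>x\<in>S. f differentiable (at x)) \<and> (\<forall>v. Ck_on n S (\<lambda>x. frechet_derivative f (at x) v))"

text \<open>Smoothness on an arbitrary (for instance half-open) set \<open>X\<close> is smoothness of an extension
  to an open neighbourhood of \<open>X\<close>; the values of the total function \<open>f\<close> off \<open>X\<close> provide the
  extension. The sets to which this is applied lie in the closure of their interior, so that the
  two-sided derivatives at boundary points do not depend on the extension.\<close>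

definition smooth_on :: "'a::real_normed_vector set \<Rightarrow> ('a \<Rightarrow> 'b::real_normed_vector) \<Rightarrow> bool" where
  "smooth_on X f \<longleftrightarrow> (\<exists>S. open S \<and> X \<subseteq> S \<and> (\<forall>n. Ck_on n S f))"


section \<open>Tensor calculus in a coordinate chart\<close>

definition pd :: "'n::finite \<Rightarrow> (real^'n \<Rightarrow> real) \<Rightarrow> real^'n \<Rightarrow> real" where
  "pd i F x = deriv (\<lambda>s. F (x + s *\<^sub>R axis i 1)) 0"

type_synonym 'n metric = "real^'n \<Rightarrow> real^'n^'n"

abbreviation inv_metric :: "'n::finite metric \<Rightarrow> 'n metric" where
  "inv_metric g x \<equiv> matrix_inv (g x)"

definition lower :: "'n::finite metric \<Rightarrow> real^'n \<Rightarrow> real^'n \<Rightarrow> 'n \<Rightarrow> real" where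
  "lower g x v \<mu> = (\<Sum>\<nu>\<in>UNIV. g x $ \<mu> $ \<nu> * v $ \<nu>)"

definition christoffel :: "'n::finite metric \<Rightarrow> 'n \<Rightarrow> 'n \<Rightarrow> 'n \<Rightarrow> real^'n \<Rightarrow> real" where
  "christoffel g \<rho> \<mu> \<nu> x = (\<Sum>l\<in>UNIV. inv_metric g x $ \<rho> $ l *
      (pd \<mu> (\<lambda>z. g z $ l $ \<nu>) x + pd \<nu> (\<lambda>z. g z $ l $ \<mu>) x - pd l (\<lambda>z. g z $ \<mu> $ \<nu>) x)) / 2"

text \<open>The sign convention is
  \<open>R\<^sup>\<rho>\<^sub>\<sigma>\<^sub>\<mu>\<^sub>\<nu> = \<partial>\<^sub>\<nu> \<Gamma>\<^sup>\<rho>\<^sub>\<sigma>\<^sub>\<mu> + \<Gamma>\<^sup>\<rho>\<^sub>\<lambda>\<^sub>\<nu> \<Gamma>\<^sup>\<lambda>\<^sub>\<sigma>\<^sub>\<mu> - (\<mu> \<leftrightarrow> \<nu>)\<close>,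
  opposite to the one of Misner, Thorne and Wheeler.\<close>

definition riemann :: "'n::finite metric \<Rightarrow> 'n \<Rightarrow> 'n \<Rightarrow> 'n \<Rightarrow> 'n \<Rightarrow> real^'n \<Rightarrow> real" where
  "riemann g \<rho> \<sigma> \<mu> \<nu> x =
     (pd \<nu> (christoffel g \<rho> \<sigma> \<mu>) x
       + (\<Sum>l\<in>UNIV. christoffel g \<rho> l \<nu> x * christoffel g l \<sigma> \<mu> x))
   - (pd \<mu> (christoffel g \<rho> \<sigma> \<nu>) x
       + (\<Sum>l\<in>UNIV. christoffel g \<rho> l \<mu> x * christoffel g l \<sigma> \<nu> x))"

definition ricci :: "'n::finite metric \<Rightarrow> 'n \<Rightarrow> 'n \<Rightarrow> real^'n \<Rightarrow> real" where
  "ricci g \<mu> \<nu> x = (\<Sum>l\<in>UNIV. riemann g l \<mu> l \<nu> x)"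

definition ricci_scalar :: "'n::finite metric \<Rightarrow> real^'n \<Rightarrow> real" where
  "ricci_scalar g x = (\<Sum>\<mu>\<in>UNIV. \<Sum>\<nu>\<in>UNIV. inv_metric g x $ \<mu> $ \<nu> * ricci g \<mu> \<nu> x)"

definition cov_hessian :: "'n::finite metric \<Rightarrow> (real^'n \<Rightarrow> real) \<Rightarrow> 'n \<Rightarrow> 'n \<Rightarrow> real^'n \<Rightarrow> real" where
  "cov_hessian g F \<mu> \<nu> x = pd \<mu> (pd \<nu> F) x - (\<Sum>l\<in>UNIV. christoffel g l \<mu> \<nu> x * pd l F x)"

definition box :: "'n::finite metric \<Rightarrow> (real^'n \<Rightarrow> real) \<Rightarrow> real^'n \<Rightarrow> real" where
  "box g F x = (\<Sum>\<mu>\<in>UNIV. \<Sum>\<nu>\<in>UNIV. inv_metric g x $ \<mu> $ \<nu> * cov_hessian g F \<mu> \<nu> x)"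


section \<open>Metric f(R) gravity\<close>

text \<open>\<open>I\<close> is the interval on which the model \<open>f\<close> is defined.\<close>

definition solves_fR_equations ::
  "real \<Rightarrow> real set \<Rightarrow> (real \<Rightarrow> real) \<Rightarrow> 'n::finite metric \<Rightarrow> (real^'n \<Rightarrow> 'n \<Rightarrow> 'n \<Rightarrow> real) \<Rightarrow>
    (real^'n) set \<Rightarrow> bool" where
  "solves_fR_equations \<kappa> I f g T M \<longleftrightarrow> (\<forall>x\<in>M. ricci_scalar g x \<in> I \<and>
     (\<forall>\<mu> \<nu>. deriv f (ricci_scalar g x) * ricci g \<mu> \<nu> x - 1/2 * f (ricci_scalar g x) * g x $ \<mu> $ \<nu>
        + (cov_hessian g (\<lambda>z. deriv f (ricci_scalar g z)) \<mu> \<nu> x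
           - g x $ \<mu> $ \<nu> * box g (\<lambda>z. deriv f (ricci_scalar g z)) x)
      = - \<kappa> * T x \<mu> \<nu>))"

definition dust_tensor ::
  "'n::finite metric \<Rightarrow> (real^'n \<Rightarrow> real) \<Rightarrow> (real^'n \<Rightarrow> real^'n) \<Rightarrow> real^'n \<Rightarrow> 'n \<Rightarrow> 'n \<Rightarrow> real" where
  "dust_tensor g \<rho> u x \<mu> \<nu> = \<rho> x * lower g x (u x) \<mu> * lower g x (u x) \<nu>"


section \<open>Embedded hypersurfaces\<close>

definition tangent :: "(real^'m::finite \<Rightarrow> real^'n::finite) \<Rightarrow> 'm \<Rightarrow> real^'m \<Rightarrow> real^'n" where
  "tangent \<Phi> a y = (\<chi> \<mu>. pd a (\<lambda>z. \<Phi> z $ \<mu>) y)"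

definition induced_metric ::
  "'n::finite metric \<Rightarrow> (real^'m::finite \<Rightarrow> real^'n) \<Rightarrow> 'm \<Rightarrow> 'm \<Rightarrow> real^'m \<Rightarrow> real" where
  "induced_metric g \<Phi> a b y =
     (\<Sum>\<mu>\<in>UNIV. \<Sum>\<nu>\<in>UNIV. g (\<Phi> y) $ \<mu> $ \<nu> * tangent \<Phi> a y $ \<mu> * tangent \<Phi> b y $ \<nu>)"

text \<open>In signature \<open>(+,-,-,-)\<close> the unit normal of a timelike hypersurface is spacelike, hence the
  normalisation to \<open>-1\<close>. The existence of such a normal is what makes the hypersurface timelike.\<close>

definition unit_normal_on ::
  "(real^'m::finite) set \<Rightarrow> 'n::finite metric \<Rightarrow> (real^'m \<Rightarrow> real^'n) \<Rightarrow> (real^'m \<Rightarrow> real^'n) \<Rightarrow> bool" where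
  "unit_normal_on S g \<Phi> N \<longleftrightarrow> smooth_on S N \<and>
     (\<forall>y\<in>S. (\<Sum>\<mu>\<in>UNIV. lower g (\<Phi> y) (N y) \<mu> * N y $ \<mu>) = -1 \<and>
            (\<forall>a. (\<Sum>\<mu>\<in>UNIV. lower g (\<Phi> y) (N y) \<mu> * tangent \<Phi> a y $ \<mu>) = 0))"

text \<open>\<open>K\<^sub>a\<^sub>b = e\<^sub>a\<^sup>\<mu> e\<^sub>b\<^sup>\<nu> \<nabla>\<^sub>\<mu> n\<^sub>\<nu>\<close>. As \<open>n\<close> is only given along the hypersurface, the derivative
  \<open>e\<^sub>a\<^sup>\<mu> \<partial>\<^sub>\<mu> n\<^sub>\<nu>\<close> is the derivative of \<open>n\<^sub>\<nu>\<close> with respect to the intrinsic coordinate \<open>y\<^sup>a\<close>.\<close>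

definition extrinsic_curvature ::
  "'n::finite metric \<Rightarrow> (real^'m::finite \<Rightarrow> real^'n) \<Rightarrow> (real^'m \<Rightarrow> real^'n) \<Rightarrow> 'm \<Rightarrow> 'm \<Rightarrow> real^'m \<Rightarrow> real" where
  "extrinsic_curvature g \<Phi> N a b y =
     (\<Sum>\<nu>\<in>UNIV. tangent \<Phi> b y $ \<nu> *
        (pd a (\<lambda>z. lower g (\<Phi> z) (N z) \<nu>) y
         - (\<Sum>\<mu>\<in>UNIV. \<Sum>l\<in>UNIV.
              christoffel g l \<mu> \<nu> (\<Phi> y) * tangent \<Phi> a y $ \<mu> * lower g (\<Phi> y) (N y) l)))"

definition normal_derivative ::
  "(real^'m::finite \<Rightarrow> real^'n::finite) \<Rightarrow> (real^'m \<Rightarrow> real^'n) \<Rightarrow> (real^'n \<Rightarrow> real) \<Rightarrow> real^'m \<Rightarrow> real" where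
  "normal_derivative \<Phi> N F y = (\<Sum>\<mu>\<in>UNIV. N y $ \<mu> * pd \<mu> F (\<Phi> y))"

definition fR_junction_conditions ::
  "(real^'m::finite) set \<Rightarrow>
    'n::finite metric \<Rightarrow> (real^'m \<Rightarrow> real^'n) \<Rightarrow> (real^'m \<Rightarrow> real^'n) \<Rightarrow>
    'n metric \<Rightarrow> (real^'m \<Rightarrow> real^'n) \<Rightarrow> (real^'m \<Rightarrow> real^'n) \<Rightarrow> bool" where
  "fR_junction_conditions S g\<^sub>1 \<Phi>\<^sub>1 N\<^sub>1 g\<^sub>2 \<Phi>\<^sub>2 N\<^sub>2 \<longleftrightarrow> (\<forall>y\<in>S.
     (\<forall>a b. induced_metric g\<^sub>1 \<Phi>\<^sub>1 a b y = induced_metric g\<^sub>2 \<Phi>\<^sub>2 a b y) \<and>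
     (\<forall>a b. extrinsic_curvature g\<^sub>1 \<Phi>\<^sub>1 N\<^sub>1 a b y = extrinsic_curvature g\<^sub>2 \<Phi>\<^sub>2 N\<^sub>2 a b y) \<and>
     ricci_scalar g\<^sub>1 (\<Phi>\<^sub>1 y) = ricci_scalar g\<^sub>2 (\<Phi>\<^sub>2 y) \<and>
     normal_derivative \<Phi>\<^sub>1 N\<^sub>1 (ricci_scalar g\<^sub>1) y = normal_derivative \<Phi>\<^sub>2 N\<^sub>2 (ricci_scalar g\<^sub>2) y)"


section \<open>Interior: collapsing uniform-density dust star\<close>

text \<open>Space-time coordinates are numbered from 1: the interior ones are \<open>(\<tau>, chi, \<theta>, \<phi>)\<close>, the
  exterior ones \<open>(t, r, \<theta>, \<phi>)\<close>. The degenerate loci \<open>chi = 0\<close> and \<open>sin \<theta> = 0\<close> of the polar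
  coordinates are left out of all coordinate domains.\<close>

definition diag4 :: "real \<Rightarrow> real \<Rightarrow> real \<Rightarrow> real \<Rightarrow> real^4^4" where
  "diag4 a b c d = (\<chi> i j. if i \<noteq> j then 0
     else if i = 1 then a else if i = 2 then b else if i = 3 then c else d)"

definition interior_metric :: "real \<Rightarrow> (real \<Rightarrow> real) \<Rightarrow> 4 metric" where
  "interior_metric k a x = diag4 1
     (- ((a (x$1))\<^sup>2 / (1 - k * (x$2)\<^sup>2)))
     (- ((a (x$1))\<^sup>2 * (x$2)\<^sup>2))
     (- ((a (x$1))\<^sup>2 * (x$2)\<^sup>2 * (sin (x$3))\<^sup>2))"

definition interior_region :: "real \<Rightarrow> real \<Rightarrow> (real^4) set" where
  "interior_region \<tau>\<^sub>c chi_s =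
     {x. 0 \<le> x$1 \<and> x$1 < \<tau>\<^sub>c \<and> 0 < x$2 \<and> x$2 \<le> chi_s \<and> 0 < x$3 \<and> x$3 < pi}"

definition collapsing_dust_star ::
  "real \<Rightarrow> real set \<Rightarrow> (real \<Rightarrow> real) \<Rightarrow> real \<Rightarrow> real \<Rightarrow> real \<Rightarrow> real \<Rightarrow> (real \<Rightarrow> real) \<Rightarrow> bool" where
  "collapsing_dust_star \<kappa> I f k \<rho>\<^sub>0 chi_s \<tau>\<^sub>c a \<longleftrightarrow>
     0 < \<rho>\<^sub>0 \<and> 0 < chi_s \<and> 0 < 1 - k * chi_s\<^sup>2 \<and> 0 < \<tau>\<^sub>c \<and>
     smooth_on {0..<\<tau>\<^sub>c} a \<and> (\<forall>\<tau>\<in>{0..<\<tau>\<^sub>c}. 0 < a \<tau>) \<and>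
     a 0 = 1 \<and> deriv a 0 = 0 \<and> (\<forall>\<tau>\<in>{0<..<\<tau>\<^sub>c}. deriv a \<tau> < 0) \<and>
     solves_fR_equations \<kappa> I f (interior_metric k a)
       (dust_tensor (interior_metric k a) (\<lambda>x. \<rho>\<^sub>0 / (a (x$1))^3) (\<lambda>x. axis 1 1))
       (interior_region \<tau>\<^sub>c chi_s)"


section \<open>Exterior: spherically symmetric vacuum in areal-radius coordinates\<close>

definition exterior_metric :: "(real \<times> real \<Rightarrow> real) \<Rightarrow> (real \<times> real \<Rightarrow> real) \<Rightarrow> 4 metric" where
  "exterior_metric A B x = diag4 (A (x$1, x$2)) (- B (x$1, x$2))
     (- ((x$2)\<^sup>2)) (- ((x$2)\<^sup>2 * (sin (x$3))\<^sup>2))"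

text \<open>\<open>D\<close> is the open part of the \<open>(t,r)\<close> plane on which \<open>A\<close> and \<open>B\<close> are smooth, including
  points slightly inside the star surface; the exterior proper is the part of \<open>D\<close> with
  \<open>r \<ge> r\<^sub>*\<close> at each instant \<open>t\<close> reached by the surface.\<close>

definition exterior_region ::
  "(real \<times> real) set \<Rightarrow> real \<Rightarrow> (real \<Rightarrow> real) \<Rightarrow> (real \<Rightarrow> real) \<Rightarrow> (real^4) set" where
  "exterior_region D \<tau>\<^sub>c t_s r_s =
     {x. (x$1, x$2) \<in> D \<and> (\<exists>\<tau>\<in>{0..<\<tau>\<^sub>c}. x$1 = t_s \<tau> \<and> r_s \<tau> \<le> x$2) \<and> 0 < x$3 \<and> x$3 < pi}"

definition spherical_vacuum_exterior ::
  "real \<Rightarrow> real set \<Rightarrow> (real \<Rightarrow> real) \<Rightarrow> (real \<times> real) set \<Rightarrow> (real \<times> real \<Rightarrow> real) \<Rightarrow> (real \<times> real \<Rightarrow> real) \<Rightarrow>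
    real \<Rightarrow> (real \<Rightarrow> real) \<Rightarrow> (real \<Rightarrow> real) \<Rightarrow> bool" where
  "spherical_vacuum_exterior \<kappa> I f D A B \<tau>\<^sub>c t_s r_s \<longleftrightarrow>
     open D \<and> (\<forall>(t, r)\<in>D. 0 < r) \<and>
     smooth_on D A \<and> smooth_on D B \<and> (\<forall>z\<in>D. 0 < A z \<and> 0 < B z) \<and>
     smooth_on {0..<\<tau>\<^sub>c} t_s \<and> smooth_on {0..<\<tau>\<^sub>c} r_s \<and>
     (\<forall>\<tau>\<in>{0..<\<tau>\<^sub>c}. 0 < deriv t_s \<tau> \<and> (t_s \<tau>, r_s \<tau>) \<in> D) \<and>
     solves_fR_equations \<kappa> I f (exterior_metric A B) (\<lambda>_ _ _. 0) (exterior_region D \<tau>\<^sub>c t_s r_s)"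


section \<open>Smooth matching\<close>

definition surface_coords :: "real \<Rightarrow> (real^3) set" where
  "surface_coords \<tau>\<^sub>c = {y. 0 \<le> y$1 \<and> y$1 < \<tau>\<^sub>c \<and> 0 < y$2 \<and> y$2 < pi}"

definition interior_embedding :: "real \<Rightarrow> real^3 \<Rightarrow> real^4" where
  "interior_embedding chi_s y =
     (\<chi> i. if i = 1 then y$1 else if i = 2 then chi_s else if i = 3 then y$2 else y$3)"

definition exterior_embedding :: "(real \<Rightarrow> real) \<Rightarrow> (real \<Rightarrow> real) \<Rightarrow> real^3 \<Rightarrow> real^4" where
  "exterior_embedding t_s r_s y =
     (\<chi> i. if i = 1 then t_s (y$1) else if i = 2 then r_s (y$1) else if i = 3 then y$2 else y$3)"

text \<open>Both normals point from the interior to the exterior, which fixes them uniquely on the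
  surface.\<close>

definition smoothly_matched ::
  "real \<Rightarrow> (real \<Rightarrow> real) \<Rightarrow> real \<Rightarrow> real \<Rightarrow> (real \<times> real \<Rightarrow> real) \<Rightarrow> (real \<times> real \<Rightarrow> real) \<Rightarrow>
    (real \<Rightarrow> real) \<Rightarrow> (real \<Rightarrow> real) \<Rightarrow> bool" where
  "smoothly_matched k a chi_s \<tau>\<^sub>c A B t_s r_s \<longleftrightarrow> (\<exists>N\<^sub>e N\<^sub>i.
     unit_normal_on (surface_coords \<tau>\<^sub>c) (exterior_metric A B) (exterior_embedding t_s r_s) N\<^sub>e \<and>
     unit_normal_on (surface_coords \<tau>\<^sub>c) (interior_metric k a) (interior_embedding chi_s) N\<^sub>i \<and>
     (\<forall>y\<in>surface_coords \<tau>\<^sub>c. 0 < N\<^sub>e y $ 2 \<and> 0 < N\<^sub>i y $ 2) \<and>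
     fR_junction_conditions (surface_coords \<tau>\<^sub>c)
       (exterior_metric A B) (exterior_embedding t_s r_s) N\<^sub>e
       (interior_metric k a) (interior_embedding chi_s) N\<^sub>i)"

end

(* The Ricci scalar of the interior depends on the proper time only. Continuity of the Ricci scalar
   across the surface, at every instant of the collapse, therefore forces it to be constant in the
   whole star. The derivative terms of the field equations then vanish, and their trace becomes
   c f'(c) - 2 f(c) = - kappa rho with c the constant Ricci scalar. So the density is constant,
   whereas rho_0 / a^3 strictly increases during the collapse. *)

theory Submission
  imports Defs
begin

section \<open>Calculus of partial derivatives, smooth functions and diagonal matrices\<close>

lemma pd_eqI:
  assumes "((\<lambda>s. F (x + s *\<^sub>R axis i 1)) has_real_derivative d) (at 0)"
  shows "pd i F x = d"
  using assms unfolding pd_def by (rule DERIV_imp_deriv)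

text \<open>A partial derivative at \<open>x\<close> sees only the germ of the function there: the
  coordinate line through \<open>x\<close> stays in \<open>U\<close> for small \<open>s\<close>.
  This allows closed forms valid only on an open chart to be differentiated.\<close>

lemma pd_cong:
  assumes "open U" "x \<in> U" "\<And>z. z \<in> U \<Longrightarrow> F z = G z"
  shows "pd i F x = pd i G x"
proof -
  have "((\<lambda>s. x + s *\<^sub>R axis i 1) \<longlongrightarrow> x + 0 *\<^sub>R axis i 1) (nhds 0)"
    by (intro tendsto_intros filterlim_ident)
  then have "\<forall>\<^sub>F s in nhds 0. x + s *\<^sub>R axis i 1 \<in> U"
    using assms(1,2) by (simp add: tendsto_def)
  then have "\<forall>\<^sub>F s in nhds 0. F (x + s *\<^sub>R axis i 1) = G (x + s *\<^sub>R axis i 1)"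
    by (rule eventually_mono) (rule assms(3))
  then show ?thesis
    unfolding pd_def by (rule deriv_cong_ev) simp
qed

lemma pd_const [simp]: "pd i (\<lambda>z. c) x = 0"
  by (rule pd_eqI) simp

text \<open>Second derivatives require the first ones to vanish near \<open>x\<close>, so constancy
  has to hold on an open neighbourhood; constancy along a hypersurface would not suffice.\<close>

lemma cov_hessian_locally_constant:
  assumes "open U" "x \<in> U" "\<And>z. z \<in> U \<Longrightarrow> F z = c"
  shows "cov_hessian g F \<mu> \<nu> x = 0"
proof -
  have *: "pd i F z = 0" if "z \<in> U" for i z
    using pd_cong[OF assms(1) that assms(3)] by simp
  have "pd \<mu> (pd \<nu> F) x = 0"
    using pd_cong[OF assms(1,2) *] by simp
  then show ?thesis
    unfolding cov_hessian_def using * assms(2) by simp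
qed

lemma box_locally_constant:
  assumes "open U" "x \<in> U" "\<And>z. z \<in> U \<Longrightarrow> F z = c"
  shows "box g F x = 0"
  unfolding box_def by (simp add: cov_hessian_locally_constant[OF assms])

text \<open>On the real line the Frechet derivative in direction \<open>1\<close> is
  \<open>deriv f\<close>. Since they agree on the whole open set \<open>S\<close>, differentiability
  of the former, given by \<open>Ck_on\<close> at order two, passes to the latter.\<close>

lemma smooth_on_has_real_derivative:
  fixes f :: "real \<Rightarrow> real"
  assumes "smooth_on X f" "x \<in> X"
  shows "(f has_real_derivative deriv f x) (at x)"
    and "(deriv f has_real_derivative deriv (deriv f) x) (at x)"
proof -
  obtain S where S: "open S" "X \<subseteq> S" and C: "\<And>n. Ck_on n S f"
    using assms(1) unfolding smooth_on_def by auto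
  have diff: "f differentiable (at y)" if "y \<in> S" for y
    using C[of 1] that by simp
  then have d: "(f has_real_derivative deriv f y) (at y)" if "y \<in> S" for y
    using that DERIV_deriv_iff_real_differentiable by blast
  then show "(f has_real_derivative deriv f x) (at x)"
    using assms(2) S by blast
  have eq: "frechet_derivative f (at y) 1 = deriv f y" if "y \<in> S" for y
    using frechet_derivative_at[OF d[OF that, unfolded has_field_derivative_def]]
    by (metis mult.right_neutral)
  have "Ck_on (Suc (Suc 0)) S f" by (rule C)
  then have "(\<lambda>y. frechet_derivative f (at y) 1) differentiable (at x)"
    using assms(2) S by auto
  then have "deriv f differentiable (at x)"
    unfolding differentiable_def
    using has_derivative_transform_within_open[of "\<lambda>y. frechet_derivative f (at y) 1" _ x UNIV S "deriv f"]
      S assms(2) eq by blast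
  then show "(deriv f has_real_derivative deriv (deriv f) x) (at x)"
    using DERIV_deriv_iff_real_differentiable by blast
qed

text \<open>\<open>matrix_inv\<close> is a Hilbert choice. The explicit two-sided inverse
  \<open>?B\<close> shows that the choice is a genuine inverse, and multiplying by \<open>?B\<close>
  from the left identifies it with \<open>?B\<close>.\<close>

lemma matrix_inv_diag4:
  assumes "a \<noteq> 0" "b \<noteq> 0" "c \<noteq> 0" "d \<noteq> 0"
  shows "matrix_inv (diag4 a b c d) = diag4 (1/a) (1/b) (1/c) (1/d)"
proof -
  let ?A = "diag4 a b c d" and ?B = "diag4 (1/a) (1/b) (1/c) (1/d)"
  have AB: "?A ** ?B = mat 1" and BA: "?B ** ?A = mat 1"
    using assms by (simp_all add: vec_eq_iff forall_4 diag4_def matrix_matrix_mult_def sum_4 mat_def)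
  have "?A ** matrix_inv ?A = mat 1"
    unfolding matrix_inv_def by (rule someI2[of _ ?B]) (use AB BA in auto)
  then have "?B ** ?A ** matrix_inv ?A = ?B"
    by (metis matrix_mul_assoc matrix_mul_rid)
  then show ?thesis
    by (simp add: BA)
qed

lemma diag4_nth [simp]:
  "diag4 a b c d $ 1 $ 1 = a" "diag4 a b c d $ 2 $ 2 = b"
  "diag4 a b c d $ 3 $ 3 = c" "diag4 a b c d $ 4 $ 4 = d"
  "i \<noteq> j \<Longrightarrow> diag4 a b c d $ i $ j = 0"
  by (simp_all add: diag4_def)

section \<open>Curvature of the Friedmann-Lemaitre-Robertson-Walker metric\<close>

locale flrw =
  fixes k :: real and a :: "real \<Rightarrow> real" and T :: "real set"
  assumes open_T: "open T"
    and nonzero: "t \<in> T \<Longrightarrow> a t \<noteq> 0"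
    and deriv1: "t \<in> T \<Longrightarrow> (a has_real_derivative deriv a t) (at t)"
    and deriv2: "t \<in> T \<Longrightarrow> (deriv a has_real_derivative deriv (deriv a) t) (at t)"
begin

text \<open>The radial coordinate is not bounded by the star radius. The set is therefore open and
  is a neighbourhood even of points on the stellar surface, where the same metric formula is
  continued outwards.\<close>

definition chart :: "(real^4) set" where
  "chart = {x. x$1 \<in> T \<and> x$2 \<noteq> 0 \<and> 1 - k * (x$2)\<^sup>2 \<noteq> 0 \<and> sin (x$3) \<noteq> 0}"

lemma open_chart: "open chart"
proof -
  have "open ((\<lambda>x::real^4. x$1) -` T)"
    by (rule open_vimage[OF open_T]) (intro continuous_intros)
  moreover have "chart = (\<lambda>x. x$1) -` T \<inter> {x. x$2 \<noteq> 0} \<inter> {x. 1 - k * (x$2)\<^sup>2 \<noteq> 0} \<inter> {x. sin (x$3) \<noteq> 0}"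
    unfolding chart_def by auto
  ultimately show ?thesis
    by (auto intro!: open_Int open_Collect_neq continuous_intros)
qed

lemma DERIV_a [derivative_intros]:
  assumes "(h has_real_derivative h') (at s)" "h s \<in> T"
  shows "((\<lambda>s. a (h s)) has_real_derivative deriv a (h s) * h') (at s)"
  using DERIV_chain2[OF deriv1 assms(1)] assms(2) by simp

lemma DERIV_a' [derivative_intros]:
  assumes "(h has_real_derivative h') (at s)" "h s \<in> T"
  shows "((\<lambda>s. deriv a (h s)) has_real_derivative deriv (deriv a) (h s) * h') (at s)"
  using DERIV_chain2[OF deriv2 assms(1)] assms(2) by simp

text \<open>Trading \<open>k\<close> for \<open>w = 1 - k r\<^sup>2\<close> turns all denominators into monomials, which keeps
  \<open>field_simps\<close> tractable.\<close>

lemma chart_E: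
  assumes "x \<in> chart"
  obtains w where "k = (1 - w) / (x$2 * x$2)" "x$1 \<in> T"
    "w \<noteq> 0" "a (x$1) \<noteq> 0" "x$2 \<noteq> 0" "sin (x$3) \<noteq> 0"
proof
  show "k = (1 - (1 - k * (x$2)\<^sup>2)) / (x$2 * x$2)"
    using assms by (simp add: chart_def power2_eq_square)
qed (use assms nonzero in \<open>auto simp: chart_def\<close>)

text \<open>These are the Christoffel symbols in closed form, with the cases sorted by the upper
  index. As \<open>\<rho> = 1\<close> is caught first, the Hubble rate \<open>deriv a / a\<close>
  appears only for a spatial upper index.\<close>

definition \<Gamma> :: "4 \<Rightarrow> 4 \<Rightarrow> 4 \<Rightarrow> real^4 \<Rightarrow> real" where
  "\<Gamma> \<rho> \<mu> \<nu> x =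
    (if \<rho> = 1 then
       (if \<mu> \<noteq> \<nu> \<or> \<mu> = 1 then 0
        else if \<mu> = 2 then a (x$1) * deriv a (x$1) / (1 - k * (x$2)\<^sup>2)
        else if \<mu> = 3 then a (x$1) * deriv a (x$1) * (x$2)\<^sup>2
        else a (x$1) * deriv a (x$1) * (x$2)\<^sup>2 * (sin (x$3))\<^sup>2)
     else if (\<mu> = 1 \<and> \<nu> = \<rho>) \<or> (\<mu> = \<rho> \<and> \<nu> = 1) then deriv a (x$1) / a (x$1)
     else if \<rho> = 2 then
       (if \<mu> \<noteq> \<nu> \<or> \<mu> = 1 then 0
        else if \<mu> = 2 then k * x$2 / (1 - k * (x$2)\<^sup>2)
        else if \<mu> = 3 then - (x$2 * (1 - k * (x$2)\<^sup>2))
        else - (x$2 * (1 - k * (x$2)\<^sup>2) * (sin (x$3))\<^sup>2))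
     else if (\<mu> = 2 \<and> \<nu> = \<rho>) \<or> (\<mu> = \<rho> \<and> \<nu> = 2) then 1 / x$2
     else if \<rho> = 3 then (if \<mu> = 4 \<and> \<nu> = 4 then - (sin (x$3) * cos (x$3)) else 0)
     else if (\<mu> = 3 \<and> \<nu> = 4) \<or> (\<mu> = 4 \<and> \<nu> = 3) then cos (x$3) / sin (x$3)
     else 0)"

lemma inv_interior_metric:
  assumes "x \<in> chart"
  shows "inv_metric (interior_metric k a) x = diag4 1
     (- ((1 - k * (x$2)\<^sup>2) / (a (x$1))\<^sup>2))
     (- (1 / ((a (x$1))\<^sup>2 * (x$2)\<^sup>2)))
     (- (1 / ((a (x$1))\<^sup>2 * (x$2)\<^sup>2 * (sin (x$3))\<^sup>2)))"
  unfolding interior_metric_def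
  using assms nonzero by (subst matrix_inv_diag4) (auto simp: chart_def)

lemma pd_interior_metric:
  assumes "x \<in> chart"
  shows "pd i (\<lambda>z. interior_metric k a z $ m $ n) x =
    (if m \<noteq> n \<or> m = 1 then 0
     else if m = 2 then
       (if i = 1 then - (2 * a (x$1) * deriv a (x$1) / (1 - k * (x$2)\<^sup>2))
        else if i = 2 then - ((a (x$1))\<^sup>2 * (2 * k * x$2) / (1 - k * (x$2)\<^sup>2)\<^sup>2) else 0)
     else if m = 3 then
       (if i = 1 then - (2 * a (x$1) * deriv a (x$1) * (x$2)\<^sup>2)
        else if i = 2 then - ((a (x$1))\<^sup>2 * (2 * x$2)) else 0)
     else
       (if i = 1 then - (2 * a (x$1) * deriv a (x$1) * (x$2)\<^sup>2 * (sin (x$3))\<^sup>2)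
        else if i = 2 then - ((a (x$1))\<^sup>2 * (2 * x$2) * (sin (x$3))\<^sup>2)
        else if i = 3 then - ((a (x$1))\<^sup>2 * (x$2)\<^sup>2 * (2 * sin (x$3) * cos (x$3))) else 0))"
    (is "?L i m n = ?R i m n")
proof -
  obtain w where k: "k = (1 - w) / (x$2 * x$2)" and t: "x$1 \<in> T"
    and nz: "w \<noteq> 0" "a (x$1) \<noteq> 0" "x$2 \<noteq> 0" "sin (x$3) \<noteq> 0"
    using assms by (rule chart_E)
  \<comment> \<open>Quantifying over the indices lets \<open>forall_4\<close> split the claim into
    one goal per triple of numerals, where the conditionals can be evaluated.\<close>
  have "\<forall>i m n. ?L i m n = ?R i m n"
    unfolding forall_4 interior_metric_def
    using nz t
    by (intro conjI; intro pd_eqI)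
      (auto intro!: derivative_eq_intros
        simp: chart_def diag4_def axis_def power2_eq_square field_simps k)
  then show ?thesis by blast
qed

lemma christoffel_interior:
  assumes "x \<in> chart"
  shows "christoffel (interior_metric k a) \<rho> \<mu> \<nu> x = \<Gamma> \<rho> \<mu> \<nu> x"
proof -
  obtain w where k: "k = (1 - w) / (x$2 * x$2)"
    and nz: "w \<noteq> 0" "a (x$1) \<noteq> 0" "x$2 \<noteq> 0" "sin (x$3) \<noteq> 0"
    using assms by (rule chart_E)
  have "\<forall>\<rho> \<mu> \<nu>. christoffel (interior_metric k a) \<rho> \<mu> \<nu> x = \<Gamma> \<rho> \<mu> \<nu> x"
    unfolding christoffel_def sum_4 inv_interior_metric[OF assms] pd_interior_metric[OF assms] forall_4
    using nz by (simp add: \<Gamma>_def) (simp add: power2_eq_square divide_simps k)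
  then show ?thesis by blast
qed

text \<open>Equality of the symbols at \<open>x\<close> alone would say nothing about derivatives;
  it holds throughout the open chart.\<close>

lemma pd_christoffel_interior:
  assumes "x \<in> chart"
  shows "pd i (christoffel (interior_metric k a) \<rho> \<mu> \<nu>) x = pd i (\<Gamma> \<rho> \<mu> \<nu>) x"
  by (rule pd_cong[OF open_chart assms christoffel_interior])

text \<open>These are the derivatives entering the diagonal Ricci components. The contribution of
  \<open>l = \<mu>\<close> to \<open>ricci g \<mu> \<mu>\<close> cancels by antisymmetry, which is
  why \<open>pd 2 (\<Gamma> 2 2 2)\<close> is absent.\<close>

lemma pd_\<Gamma>:
  assumes "x \<in> chart"
  shows "pd 1 (\<Gamma> 1 2 2) x = ((deriv a (x$1))\<^sup>2 + a (x$1) * deriv (deriv a) (x$1)) / (1 - k * (x$2)\<^sup>2)"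
    "pd 1 (\<Gamma> 1 3 3) x = ((deriv a (x$1))\<^sup>2 + a (x$1) * deriv (deriv a) (x$1)) * (x$2)\<^sup>2"
    "pd 1 (\<Gamma> 1 4 4) x =
       ((deriv a (x$1))\<^sup>2 + a (x$1) * deriv (deriv a) (x$1)) * (x$2)\<^sup>2 * (sin (x$3))\<^sup>2"
    "i \<noteq> 1 \<Longrightarrow> pd 1 (\<Gamma> i 1 i) x = deriv (deriv a) (x$1) / a (x$1) - (deriv a (x$1) / a (x$1))\<^sup>2"
    "pd 2 (\<Gamma> 2 3 3) x = - 1 + 3 * k * (x$2)\<^sup>2"
    "pd 2 (\<Gamma> 2 4 4) x = (- 1 + 3 * k * (x$2)\<^sup>2) * (sin (x$3))\<^sup>2"
    "pd 2 (\<Gamma> 3 2 3) x = - 1 / (x$2)\<^sup>2"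
    "pd 2 (\<Gamma> 4 2 4) x = - 1 / (x$2)\<^sup>2"
    "pd 3 (\<Gamma> 3 4 4) x = (sin (x$3))\<^sup>2 - (cos (x$3))\<^sup>2"
    "pd 3 (\<Gamma> 4 3 4) x = - 1 - (cos (x$3) / sin (x$3))\<^sup>2"
    "pd 2 (\<Gamma> 1 2 1) x = 0" "pd 3 (\<Gamma> 1 3 1) x = 0" "pd 3 (\<Gamma> 2 3 2) x = 0"
    "pd 4 (\<Gamma> \<rho> \<mu> \<nu>) x = 0" "pd i (\<Gamma> 1 1 1) x = 0" "i \<noteq> 1 \<Longrightarrow> pd i (\<Gamma> i 1 1) x = 0"
    "pd 3 (\<Gamma> 3 2 2) x = 0" "pd 3 (\<Gamma> 3 3 3) x = 0"
proof -
  obtain w where k: "k = (1 - w) / (x$2 * x$2)" and t: "x$1 \<in> T"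
    and nz: "w \<noteq> 0" "a (x$1) \<noteq> 0" "x$2 \<noteq> 0" "sin (x$3) \<noteq> 0"
    using assms by (rule chart_E)
  show "pd 1 (\<Gamma> 1 2 2) x = ((deriv a (x$1))\<^sup>2 + a (x$1) * deriv (deriv a) (x$1)) / (1 - k * (x$2)\<^sup>2)"
    "pd 1 (\<Gamma> 1 3 3) x = ((deriv a (x$1))\<^sup>2 + a (x$1) * deriv (deriv a) (x$1)) * (x$2)\<^sup>2"
    "pd 1 (\<Gamma> 1 4 4) x =
       ((deriv a (x$1))\<^sup>2 + a (x$1) * deriv (deriv a) (x$1)) * (x$2)\<^sup>2 * (sin (x$3))\<^sup>2"
    "pd 2 (\<Gamma> 2 3 3) x = - 1 + 3 * k * (x$2)\<^sup>2"
    "pd 2 (\<Gamma> 2 4 4) x = (- 1 + 3 * k * (x$2)\<^sup>2) * (sin (x$3))\<^sup>2"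
    "pd 2 (\<Gamma> 3 2 3) x = - 1 / (x$2)\<^sup>2"
    "pd 2 (\<Gamma> 4 2 4) x = - 1 / (x$2)\<^sup>2"
    "pd 3 (\<Gamma> 3 4 4) x = (sin (x$3))\<^sup>2 - (cos (x$3))\<^sup>2"
    "pd 3 (\<Gamma> 4 3 4) x = - 1 - (cos (x$3) / sin (x$3))\<^sup>2"
    using nz t
    by - (rule pd_eqI; simp add: \<Gamma>_def axis_def;
      auto intro!: derivative_eq_intros simp: power2_eq_square field_simps k)+
  show "i \<noteq> 1 \<Longrightarrow> pd 1 (\<Gamma> i 1 i) x = deriv (deriv a) (x$1) / a (x$1) - (deriv a (x$1) / a (x$1))\<^sup>2"
    using nz t
    by - (rule pd_eqI; auto intro!: derivative_eq_intros
      simp: \<Gamma>_def axis_def power2_eq_square field_simps)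
  show "pd 2 (\<Gamma> 1 2 1) x = 0" "pd 3 (\<Gamma> 1 3 1) x = 0" "pd 3 (\<Gamma> 2 3 2) x = 0"
    "pd 4 (\<Gamma> \<rho> \<mu> \<nu>) x = 0" "pd i (\<Gamma> 1 1 1) x = 0" "i \<noteq> 1 \<Longrightarrow> pd i (\<Gamma> i 1 1) x = 0"
    "pd 3 (\<Gamma> 3 2 2) x = 0" "pd 3 (\<Gamma> 3 3 3) x = 0"
    \<comment> \<open>With arbitrary indices the conditionals remain. Dropping the weak congruence
      rule lets the simplifier rewrite inside their branches, where the dependence on
      \<open>s\<close> disappears.\<close>
    by (rule pd_eqI; simp add: \<Gamma>_def axis_def cong del: if_weak_cong)+
qed

text \<open>Diagonal components suffice for traces, as the inverse metric is diagonal. The three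
  spatial ones are a common function of time times the metric, reflecting isotropy.\<close>

lemma ricci_interior:
  assumes "x \<in> chart"
  shows "ricci (interior_metric k a) 1 1 x = 3 * deriv (deriv a) (x$1) / a (x$1)"
    and "ricci (interior_metric k a) 2 2 x =
      - (a (x$1) * deriv (deriv a) (x$1) + 2 * (deriv a (x$1))\<^sup>2 + 2 * k) / (1 - k * (x$2)\<^sup>2)"
    and "ricci (interior_metric k a) 3 3 x =
      - (a (x$1) * deriv (deriv a) (x$1) + 2 * (deriv a (x$1))\<^sup>2 + 2 * k) * (x$2)\<^sup>2"
    and "ricci (interior_metric k a) 4 4 x =
      - (a (x$1) * deriv (deriv a) (x$1) + 2 * (deriv a (x$1))\<^sup>2 + 2 * k) * (x$2)\<^sup>2 * (sin (x$3))\<^sup>2"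
proof -
  obtain w where k: "k = (1 - w) / (x$2 * x$2)"
    and nz: "w \<noteq> 0" "a (x$1) \<noteq> 0" "x$2 \<noteq> 0" "sin (x$3) \<noteq> 0"
    using assms by (rule chart_E)
  \<comment> \<open>In product form, since squares get expanded below. It is used for the last
    component, where the derivative of \<open>sin (x$3) * cos (x$3)\<close> leaves squared
    cosines.\<close>
  have c2: "cos (x$3) * cos (x$3) = 1 - sin (x$3) * sin (x$3)"
    using cos_squared_eq[of "x$3"] by (simp add: power2_eq_square)
  note unf = ricci_def riemann_def sum_4 pd_christoffel_interior[OF assms]
    christoffel_interior[OF assms] pd_\<Gamma>[OF assms]
  show "ricci (interior_metric k a) 1 1 x = 3 * deriv (deriv a) (x$1) / a (x$1)"
    using nz by (simp add: unf, simp add: \<Gamma>_def) (simp add: power2_eq_square field_simps k)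
  show "ricci (interior_metric k a) 2 2 x =
      - (a (x$1) * deriv (deriv a) (x$1) + 2 * (deriv a (x$1))\<^sup>2 + 2 * k) / (1 - k * (x$2)\<^sup>2)"
    using nz by (simp add: unf, simp add: \<Gamma>_def) (simp add: power2_eq_square field_simps k)
  show "ricci (interior_metric k a) 3 3 x =
      - (a (x$1) * deriv (deriv a) (x$1) + 2 * (deriv a (x$1))\<^sup>2 + 2 * k) * (x$2)\<^sup>2"
    using nz by (simp add: unf, simp add: \<Gamma>_def) (simp add: power2_eq_square field_simps k)
  show "ricci (interior_metric k a) 4 4 x =
      - (a (x$1) * deriv (deriv a) (x$1) + 2 * (deriv a (x$1))\<^sup>2 + 2 * k) * (x$2)\<^sup>2 * (sin (x$3))\<^sup>2"
    using nz by (simp add: unf, simp add: \<Gamma>_def) (simp add: power2_eq_square field_simps c2 k)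
qed

text \<open>Each spatial component contributes equally to the trace, so the radius and angle cancel.
  Only \<open>x$1\<close> survives, which later carries a value from one surface point to all points
  of the same instant.\<close>

lemma ricci_scalar_interior:
  assumes "x \<in> chart"
  shows "ricci_scalar (interior_metric k a) x =
    6 * (((deriv a (x$1))\<^sup>2 + k) / (a (x$1))\<^sup>2 + deriv (deriv a) (x$1) / a (x$1))"
proof -
  obtain w where k: "k = (1 - w) / (x$2 * x$2)"
    and nz: "w \<noteq> 0" "a (x$1) \<noteq> 0" "x$2 \<noteq> 0" "sin (x$3) \<noteq> 0"
    using assms by (rule chart_E)
  show ?thesis
    using nz unfolding ricci_scalar_def sum_4 inv_interior_metric[OF assms]
    by (simp add: ricci_interior[OF assms]) (simp add: power2_eq_square field_simps k)
qed

section \<open>Trace of the field equations for dust with constant Ricci scalar\<close>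

lemma dust_density_of_constant_ricci_scalar:
  assumes eqs: "solves_fR_equations \<kappa> I f (interior_metric k a)
      (dust_tensor (interior_metric k a) \<rho> (\<lambda>x. axis 1 1)) M"
    and const: "\<And>z. z \<in> chart \<Longrightarrow> ricci_scalar (interior_metric k a) z = c"
    and x: "x \<in> chart" "x \<in> M"
  shows "\<kappa> * \<rho> x = 2 * f c - c * deriv f c"
proof -
  let ?g = "interior_metric k a"
  let ?i = "\<lambda>\<mu>. inv_metric ?g x $ \<mu> $ \<mu>"
  have "cov_hessian ?g (\<lambda>z. deriv f (ricci_scalar ?g z)) \<mu> \<nu> x = 0" for \<mu> \<nu>
    by (rule cov_hessian_locally_constant[OF open_chart x(1)]) (simp add: const)
  moreover have "box ?g (\<lambda>z. deriv f (ricci_scalar ?g z)) x = 0"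
    by (rule box_locally_constant[OF open_chart x(1)]) (simp add: const)
  ultimately have E: "deriv f c * ricci ?g \<mu> \<nu> x - 1/2 * f c * ?g x $ \<mu> $ \<nu>
      = - \<kappa> * dust_tensor ?g \<rho> (\<lambda>x. axis 1 1) x \<mu> \<nu>" for \<mu> \<nu>
    using eqs x const unfolding solves_fR_equations_def by fastforce
  \<comment> \<open>Dust is at rest in these coordinates, so its tensor has only the time-time
    component \<open>\<rho> x\<close>.\<close>
  have low: "lower ?g x (axis 1 1) \<mu> = (if \<mu> = 1 then 1 else 0)" for \<mu>
    by (simp add: lower_def sum_4 axis_def interior_metric_def diag4_def)
  have E1: "?i 1 * (deriv f c * ricci ?g 1 1 x - 1/2 * f c * ?g x $ 1 $ 1) = - \<kappa> * \<rho> x"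
    unfolding E by (simp add: dust_tensor_def low inv_interior_metric[OF x(1)])
  have E0: "?i \<mu> * (deriv f c * ricci ?g \<mu> \<mu> x - 1/2 * f c * ?g x $ \<mu> $ \<mu>) = 0" if "\<mu> \<noteq> 1" for \<mu>
    unfolding E using that by (simp add: dust_tensor_def low)
  have tr: "?i 1 * ricci ?g 1 1 x + ?i 2 * ricci ?g 2 2 x + ?i 3 * ricci ?g 3 3 x
      + ?i 4 * ricci ?g 4 4 x = c"
    using const[OF x(1)] unfolding ricci_scalar_def sum_4
    by (simp add: inv_interior_metric[OF x(1)])
  have inv: "?i \<mu> * ?g x $ \<mu> $ \<mu> = 1" for \<mu>
  proof -
    have "\<forall>\<mu>. ?i \<mu> * ?g x $ \<mu> $ \<mu> = 1"
      unfolding inv_interior_metric[OF x(1)] forall_4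
      using x(1) nonzero by (auto simp: chart_def interior_metric_def field_simps)
    then show ?thesis by blast
  qed
  \<comment> \<open>Contraction of the diagonal equations: each of the four dimensions contributes
    \<open>- 1/2 * f c\<close>, whence the total \<open>- 2 * f c\<close>.\<close>
  have "?i \<mu> * (deriv f c * ricci ?g \<mu> \<mu> x - 1/2 * f c * ?g x $ \<mu> $ \<mu>)
      = deriv f c * (?i \<mu> * ricci ?g \<mu> \<mu> x) - 1/2 * f c" for \<mu>
    using inv[of \<mu>] by (simp add: algebra_simps)
  then have "- \<kappa> * \<rho> x = deriv f c * (?i 1 * ricci ?g 1 1 x + ?i 2 * ricci ?g 2 2 x
      + ?i 3 * ricci ?g 3 3 x + ?i 4 * ricci ?g 4 4 x) - 2 * f c"
    using E1 E0[of 2] E0[of 3] E0[of 4] by (simp add: distrib_left)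
  then show ?thesis
    unfolding tr by (simp add: mult.commute)
qed

end

section \<open>Matching to a constant exterior Ricci scalar contradicts the collapse\<close>

theorem mainTheorem1:
  fixes \<kappa> k \<rho>\<^sub>0 chi_s \<tau>\<^sub>c :: real
    and I :: "real set"
    and f a t_s r_s :: "real \<Rightarrow> real"
    and D :: "(real \<times> real) set"
    and A B :: "real \<times> real \<Rightarrow> real"
  assumes "0 < \<kappa>"
    and "is_interval I" and "interior I \<noteq> {}"
    and "smooth_on I f"
    and "\<forall>R\<in>I. deriv (deriv f) R \<noteq> 0"
    and "collapsing_dust_star \<kappa> I f k \<rho>\<^sub>0 chi_s \<tau>\<^sub>c a"
    and "spherical_vacuum_exterior \<kappa> I f D A B \<tau>\<^sub>c t_s r_s"
    and "ricci_scalar (exterior_metric A B) constant_on exterior_region D \<tau>\<^sub>c t_s r_s"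
  shows "\<not> smoothly_matched k a chi_s \<tau>\<^sub>c A B t_s r_s"
proof
  assume "smoothly_matched k a chi_s \<tau>\<^sub>c A B t_s r_s"
  then have match: "ricci_scalar (exterior_metric A B) (exterior_embedding t_s r_s y)
      = ricci_scalar (interior_metric k a) (interior_embedding chi_s y)"
    if "y \<in> surface_coords \<tau>\<^sub>c" for y
    using that unfolding smoothly_matched_def fR_junction_conditions_def by blast
  obtain c where c: "\<And>x. x \<in> exterior_region D \<tau>\<^sub>c t_s r_s \<Longrightarrow> ricci_scalar (exterior_metric A B) x = c"
    using assms(8) unfolding constant_on_def by blast
  have star: "0 < \<rho>\<^sub>0" "0 < chi_s" "0 < 1 - k * chi_s\<^sup>2" "0 < \<tau>\<^sub>c" "smooth_on {0..<\<tau>\<^sub>c} a"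
    and pos: "\<And>\<tau>. \<tau> \<in> {0..<\<tau>\<^sub>c} \<Longrightarrow> 0 < a \<tau>"
    and collapse: "\<And>\<tau>. \<tau> \<in> {0<..<\<tau>\<^sub>c} \<Longrightarrow> deriv a \<tau> < 0"
    and eqs: "solves_fR_equations \<kappa> I f (interior_metric k a)
       (dust_tensor (interior_metric k a) (\<lambda>x. \<rho>\<^sub>0 / (a (x$1))^3) (\<lambda>x. axis 1 1))
       (interior_region \<tau>\<^sub>c chi_s)"
    using assms(6) unfolding collapsing_dust_star_def by auto
  \<comment> \<open>The initial instant is left out because the time domain of the chart must be
    open.\<close>
  interpret flrw k a "{0<..<\<tau>\<^sub>c}"
  proof
    fix t assume "t \<in> {0<..<\<tau>\<^sub>c}"
    then have t: "t \<in> {0..<\<tau>\<^sub>c}" by simp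
    show "a t \<noteq> 0" using pos[OF t] by simp
    show "(a has_real_derivative deriv a t) (at t)"
      "(deriv a has_real_derivative deriv (deriv a) t) (at t)"
      using smooth_on_has_real_derivative[OF star(5) t] by blast+
  qed simp
  \<comment> \<open>One sample point of the surface per instant, on the equator and so away from the
    poles where the chart degenerates.\<close>
  define y :: "real \<Rightarrow> real^3" where "y \<tau> = (\<chi> i. if i = 1 then \<tau> else pi / 2)" for \<tau>
  define p where "p \<tau> = interior_embedding chi_s (y \<tau>)" for \<tau>
  have p: "p \<tau> $ 1 = \<tau>" "p \<tau> $ 2 = chi_s" "p \<tau> $ 3 = pi / 2" for \<tau>
    by (simp_all add: p_def y_def interior_embedding_def)
  have p_chart: "p \<tau> \<in> chart" and p_star: "p \<tau> \<in> interior_region \<tau>\<^sub>c chi_s" if "\<tau> \<in> {0<..<\<tau>\<^sub>c}" for \<tau>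
    using that star by (auto simp: chart_def p interior_region_def)
  have R_p: "ricci_scalar (interior_metric k a) (p \<tau>) = c" if "\<tau> \<in> {0<..<\<tau>\<^sub>c}" for \<tau>
  proof -
    have "y \<tau> \<in> surface_coords \<tau>\<^sub>c"
      using that by (simp add: y_def surface_coords_def)
    \<comment> \<open>The exterior region includes its boundary \<open>r = r_s \<tau>\<close>, so
      the constant \<open>c\<close> is also the exterior value on the surface.\<close>
    moreover have "exterior_embedding t_s r_s (y \<tau>) \<in> exterior_region D \<tau>\<^sub>c t_s r_s"
      using that assms(7)
      by (force simp: y_def exterior_embedding_def exterior_region_def spherical_vacuum_exterior_def)
    ultimately show ?thesis
      using match c unfolding p_def by metis
  qed
  have R_chart: "ricci_scalar (interior_metric k a) z = c" if "z \<in> chart" for z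
  proof -
    have t: "z $ 1 \<in> {0<..<\<tau>\<^sub>c}"
      using that by (simp add: chart_def)
    \<comment> \<open>The point \<open>z\<close> and the surface point \<open>p (z $ 1)\<close>
      share their proper time, hence their Ricci scalar.\<close>
    show ?thesis
      using R_p[OF t] unfolding ricci_scalar_interior[OF that] ricci_scalar_interior[OF p_chart[OF t]] p .
  qed
  have density: "\<kappa> * (\<rho>\<^sub>0 / a \<tau> ^ 3) = 2 * f c - c * deriv f c" if "\<tau> \<in> {0<..<\<tau>\<^sub>c}" for \<tau>
    using dust_density_of_constant_ricci_scalar[OF eqs R_chart p_chart[OF that] p_star[OF that]]
    by (simp add: p)
  \<comment> \<open>Any two distinct instants strictly inside the collapse would do: between them
    \<open>deriv a\<close> is negative, so the densities differ, while \<open>density\<close> makes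
    them equal.\<close>
  define s t where "s = \<tau>\<^sub>c / 3" and "t = 2 * \<tau>\<^sub>c / 3"
  have st: "s < t" "{s..t} \<subseteq> {0<..<\<tau>\<^sub>c}"
    using star(4) by (auto simp: s_def t_def)
  have "a t < a s"
  proof (rule DERIV_neg_imp_decreasing[OF st(1)])
    fix u assume "s \<le> u" "u \<le> t"
    then have "u \<in> {0<..<\<tau>\<^sub>c}" using st(2) by auto
    then show "\<exists>d. (a has_real_derivative d) (at u) \<and> d < 0"
      using deriv1 collapse by blast
  qed
  moreover have s: "s \<in> {0<..<\<tau>\<^sub>c}" and t: "t \<in> {0<..<\<tau>\<^sub>c}"
    using star(4) by (auto simp: s_def t_def)
  moreover have "0 < a t" "0 < a s"
    using pos[of s] pos[of t] s t by auto
  ultimately have "\<rho>\<^sub>0 / a s ^ 3 < \<rho>\<^sub>0 / a t ^ 3"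
    using star(1) by (intro divide_strict_left_mono power_strict_mono mult_pos_pos zero_less_power) auto
  moreover have "\<kappa> * (\<rho>\<^sub>0 / a s ^ 3) = \<kappa> * (\<rho>\<^sub>0 / a t ^ 3)"
    unfolding density[OF s] density[OF t] ..
  ultimately show False
    using assms(1) by (metis less_irrefl mult_less_cancel_left_pos)
qed

end
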